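(* Let $\mathcal{G}=(\mathcal{V},\mathcal{E})$ be a finite directed graph and let $A_{TV}$ be the integer matrix with rows indexed by $\mathcal{E}$ and columns indexed by $\mathcal{V}\sqcup\mathcal{E}$ such that, for $(x,a)\in\mathbb{Z}^{\mathcal{V}}\times\mathbb{Z}^{\mathcal{E}}$, the entry of $A_{TV}(x,a)$ at $uv\in\mathcal{E}$ is $x_u-x_v-a_{uv}$. Then the Graver basis of $A_{TV}$ is precisely the set of points $$\pm\bigl(\chi_S,\ \chi_{\delta^+(S)}-\chi_{\delta^-(S)}\bigr),$$ where $S$ ranges over the nonempty subsets of $\mathcal{V}$ that induce a connected subgraph of $\mathcal{G}$.
   Context: A directed graph is $\mathcal{G}=(\mathcal{V},\mathcal{E})$ with $\mathcal{E}\subset\mathcal{V}\times\mathcal{V}$; $uv$ denotes the edge leaving $u$ and arriving at $v$. The subgraph induced by $S\subset\mathcal{V}$ is $(S,\mathcal{E}\cap(S\times S))$. "Connected" means weakly connected: ignoring edge directions, any two vertices are joined by a path. $\delta^+(S)=\{uv\in\mathcal{E}:u\in S\}$ and $\delta^-(S)=\{uv\in\mathcal{E}:v\in S\}$. For $S\subset\mathcal{V}$, $\chi_S\in\{0,1\}^{\mathcal{V}}$ is the indicator vector of $S$; for $T\subset\mathcal{E}$, $\chi_T\in\{0,1\}^{\mathcal{E}}$ is the indicator vector of $T$. For $y,z\in\mathbb{Z}^n$, write $y\sqsubseteq z$ if $y_iz_i\ge 0$ and $|y_i|\le|z_i|$ for all $i$. For an integer matrix $A$ with $n$ columns, $\ker_{\mathbb{Z}}(A)=\ker(A)\cap\mathbb{Z}^n$,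 and the Graver basis of $A$ is the set of $\sqsubseteq$-minimal elements of $\ker_{\mathbb{Z}}(A)\setminus\{0\}$. (In matrix form, $A_{TV}=[\,B\ \ -I\,]$ with $B$ the transpose of the oriented incidence matrix of $\mathcal{G}$.) *)

theory Defs
  imports "Graph_Theory.Digraph_Component" "HOL-Library.Indicator_Function"
begin

text \<open>
  For a finite index set \<open>C\<close>, vectors in \<open>\<int>\<^sup>C\<close> are functions that vanish outside \<open>C\<close>, so that
  equality of functions is equality of vectors.  Matrices are functions of a row index and a
  column index, with the index sets \<open>R\<close> and \<open>C\<close> given explicitly; entries outside \<open>R\<close> and \<open>C\<close> are
  never consulted.
\<close>

definition int_vectors :: "'c set \<Rightarrow> ('c \<Rightarrow> int) set" where
  "int_vectors C = {z. \<forall>i. i \<notin> C \<longrightarrow> z i = 0}"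

definition matrix_vector :: "'c set \<Rightarrow> ('r \<Rightarrow> 'c \<Rightarrow> int) \<Rightarrow> ('c \<Rightarrow> int) \<Rightarrow> 'r \<Rightarrow> int" where
  "matrix_vector C A z r = (\<Sum>c\<in>C. A r c * z c)"

definition int_kernel :: "'r set \<Rightarrow> 'c set \<Rightarrow> ('r \<Rightarrow> 'c \<Rightarrow> int) \<Rightarrow> ('c \<Rightarrow> int) set" where
  "int_kernel R C A = {z \<in> int_vectors C. \<forall>r\<in>R. matrix_vector C A z r = 0}"

definition conformal :: "'c set \<Rightarrow> ('c \<Rightarrow> int) \<Rightarrow> ('c \<Rightarrow> int) \<Rightarrow> bool" where
  "conformal C y z \<longleftrightarrow> (\<forall>i\<in>C. y i * z i \<ge> 0 \<and> \<bar>y i\<bar> \<le> \<bar>z i\<bar>)"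

definition graver_basis :: "'r set \<Rightarrow> 'c set \<Rightarrow> ('r \<Rightarrow> 'c \<Rightarrow> int) \<Rightarrow> ('c \<Rightarrow> int) set" where
  "graver_basis R C A =
    {z \<in> int_kernel R C A - {\<lambda>_. 0}.
      \<forall>y \<in> int_kernel R C A - {\<lambda>_. 0}. conformal C y z \<longrightarrow> y = z}"

text \<open>
  The matrix \<open>[B -I]\<close>, where \<open>B\<close> is the transpose of the oriented incidence matrix.  On a loop the two summands of the \<open>B\<close>-part cancel.
\<close>

fun A_TV :: "'v \<times> 'v \<Rightarrow> 'v + 'v \<times> 'v \<Rightarrow> int" where
  "A_TV (u, v) (Inl w) = of_bool (w = u) - of_bool (w = v)"
| "A_TV (u, v) (Inr e) = - of_bool (e = (u, v))"

lemma (in pair_fin_digraph) matrix_vector_A_TV: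
  assumes "(u, v) \<in> parcs G"
  shows "matrix_vector (pverts G <+> parcs G) A_TV (case_sum x a) (u, v) = x u - x v - a (u, v)"
proof -
  have uv: "u \<in> pverts G" "v \<in> pverts G"
    using assms by (auto dest: in_arcsD1 in_arcsD2)
  have "matrix_vector (pverts G <+> parcs G) A_TV (case_sum x a) (u, v) =
      (\<Sum>w\<in>pverts G. (of_bool (w = u) - of_bool (w = v)) * x w) +
      (\<Sum>e\<in>parcs G. - of_bool (e = (u, v)) * a e)"
    unfolding matrix_vector_def using pair_finite_verts pair_finite_arcs
    by (simp add: sum.Plus)
  also have "(\<Sum>w\<in>pverts G. (of_bool (w = u) - of_bool (w = v)) * x w) =
      (\<Sum>w\<in>pverts G. if w = u then x w else 0) - (\<Sum>w\<in>pverts G. if w = v then x w else 0)"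
    unfolding sum_subtractf[symmetric] by (rule sum.cong) auto
  also have "\<dots> = x u - x v"
    using uv pair_finite_verts by simp
  also have "(\<Sum>e\<in>parcs G. - of_bool (e = (u, v)) * a e) =
      - (\<Sum>e\<in>parcs G. if e = (u, v) then a e else 0)"
    unfolding sum_negf[symmetric] by (rule sum.cong) auto
  also have "\<dots> = - a (u, v)"
    using assms pair_finite_arcs by simp
  finally show ?thesis by simp
qed

definition arcs_leaving :: "'v pair_pre_digraph \<Rightarrow> 'v set \<Rightarrow> ('v \<times> 'v) set" where
  "arcs_leaving G S = {(u, v) \<in> parcs G. u \<in> S}"

definition arcs_entering :: "'v pair_pre_digraph \<Rightarrow> 'v set \<Rightarrow> ('v \<times> 'v) set" where
  "arcs_entering G S = {(u, v) \<in> parcs G. v \<in> S}"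

definition cut_vector :: "'v pair_pre_digraph \<Rightarrow> 'v set \<Rightarrow> 'v + 'v \<times> 'v \<Rightarrow> int" where
  "cut_vector G S =
    case_sum (indicator S) (\<lambda>e. indicator (arcs_leaving G S) e - indicator (arcs_entering G S) e)"

end

(* A kernel vector (x, a) is determined by x, since a is the vector of differences of x along the arcs.
   If some x v > 0, a component S of {v. x v > 0} gives a cut vector that is conformal to (x, a):
   an arc that leaves S ends where x is nonpositive, so x drops along it by at least 1.
   Conversely, a nonzero kernel vector conformal to the cut vector of S has no difference on the
   arcs inside S, so it is constant on S if S is connected. *)

theory Submission
  imports Defs
begin

section \<open>Connectedness and components of induced subgraphs\<close>

lemma reachable_mk_symmetric_induce_iff:
  "u \<rightarrow>\<^sup>*\<^bsub>with_proj (mk_symmetric (with_proj G \<restriction> S))\<^esub> v \<longleftrightarrow>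
    (u, v) \<in> rtrancl_on S {(a, b). a \<in> S \<and> b \<in> S \<and> ((a, b) \<in> parcs G \<or> (b, a) \<in> parcs G)}"
proof -
  have "parcs (mk_symmetric (with_proj G \<restriction> S)) =
      {(a, b). a \<in> S \<and> b \<in> S \<and> ((a, b) \<in> parcs G \<or> (b, a) \<in> parcs G)}"
    by (force simp: parcs_mk_symmetric induce_subgraph_def)
  then show ?thesis
    by (simp add: reachable_def)
qed

text \<open>A set closed under arcs in both directions contains everything weakly reachable from any
  of its points, and the set reachable from a point is itself closed. This trades paths for closed
  sets, so that a component can be found by minimality and constancy along arcs can be used
  directly.\<close>

lemma connected_induce_iff:
  "Digraph_Component.connected (with_proj G \<restriction> S) \<longleftrightarrow>
    S \<noteq> {} \<and> (\<forall>T \<subseteq> S. T \<noteq> {} \<longrightarrow>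
      (\<forall>(u, v) \<in> parcs G. u \<in> S \<longrightarrow> v \<in> S \<longrightarrow> (u \<in> T \<longleftrightarrow> v \<in> T)) \<longrightarrow> T = S)"
  (is "?L \<longleftrightarrow> _ \<and> ?R")
proof -
  define r where "r = {(a, b). a \<in> S \<and> b \<in> S \<and> ((a, b) \<in> parcs G \<or> (b, a) \<in> parcs G)}"
  have L: "?L \<longleftrightarrow> S \<noteq> {} \<and> (\<forall>u\<in>S. \<forall>v\<in>S. (u, v) \<in> rtrancl_on S r)"
    unfolding Digraph_Component.connected_def strongly_connected_def
    by (simp add: reachable_mk_symmetric_induce_iff r_def)
  have "(\<forall>u\<in>S. \<forall>v\<in>S. (u, v) \<in> rtrancl_on S r) \<longleftrightarrow> ?R"
  proof
    assume reach: "\<forall>u\<in>S. \<forall>v\<in>S. (u, v) \<in> rtrancl_on S r"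
    show ?R
    proof (intro allI impI)
      fix T
      assume T: "T \<subseteq> S" "T \<noteq> {}"
        and closed: "\<forall>(u, v) \<in> parcs G. u \<in> S \<longrightarrow> v \<in> S \<longrightarrow> (u \<in> T \<longleftrightarrow> v \<in> T)"
      obtain u where u: "u \<in> T"
        using T by blast
      have "v \<in> T" if "(u, v) \<in> rtrancl_on S r" for v
        using that by (induction rule: rtrancl_on_induct) (use u closed in \<open>auto simp: r_def\<close>)
      then show "T = S"
        using T u reach by blast
    qed
  next
    assume R: ?R
    show "\<forall>u\<in>S. \<forall>v\<in>S. (u, v) \<in> rtrancl_on S r"
    proof
      fix u
      assume "u \<in> S"
      define T where "T = {v. (u, v) \<in> rtrancl_on S r}"
      have "T \<subseteq> S"
        by (auto simp: T_def dest: in_rtrancl_on_in_F)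
      moreover have "u \<in> T"
        using \<open>u \<in> S\<close> by (auto simp: T_def)
      moreover have "b \<in> T" if "a \<in> T" "(a, b) \<in> r" for a b
        using that by (auto simp: T_def r_def intro: rtrancl_on_into_rtrancl_on)
      \<comment> \<open>Since \<open>r\<close> is symmetric, closure under its steps gives both
        directions of the equivalence.\<close>
      then have "\<forall>(a, b) \<in> parcs G. a \<in> S \<longrightarrow> b \<in> S \<longrightarrow> (a \<in> T \<longleftrightarrow> b \<in> T)"
        by (auto simp: r_def)
      ultimately have "T = S"
        using R by blast
      then show "\<forall>v\<in>S. (u, v) \<in> rtrancl_on S r"
        by (auto simp: T_def)
    qed
  qed
  then show ?thesis
    using L by blast
qed

text \<open>An inclusion-minimal nonempty subset of \<open>P\<close> closed under the arcs inside
  \<open>P\<close> is a component: a proper closed part of it would contradict minimality. Such a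
  set exists because \<open>P\<close> is finite and is itself closed.\<close>

lemma obtain_connected_component:
  assumes "finite P" "P \<noteq> {}"
  obtains S where "S \<subseteq> P" "Digraph_Component.connected (with_proj G \<restriction> S)"
    and "\<And>u v. (u, v) \<in> parcs G \<Longrightarrow> u \<in> P \<Longrightarrow> v \<in> P \<Longrightarrow> u \<in> S \<longleftrightarrow> v \<in> S"
proof -
  define closed where
    "closed S \<longleftrightarrow> (\<forall>(u, v) \<in> parcs G. u \<in> P \<longrightarrow> v \<in> P \<longrightarrow> (u \<in> S \<longleftrightarrow> v \<in> S))" for S
  define F where "F = {S. S \<subseteq> P \<and> S \<noteq> {} \<and> closed S}"
  have "finite F"
    using assms(1) by (simp add: F_def)
  moreover have "F \<noteq> {}"
    using assms(2) by (auto simp: F_def closed_def)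
  ultimately obtain S where "S \<in> F" and min: "\<forall>T\<in>F. T \<subseteq> S \<longrightarrow> S = T"
    using finite_has_minimal by metis
  then have S: "S \<subseteq> P" "S \<noteq> {}" "closed S"
    by (simp_all add: F_def)
  have "Digraph_Component.connected (with_proj G \<restriction> S)"
    unfolding connected_induce_iff
  proof (intro conjI allI impI)
    fix T
    assume "T \<subseteq> S" "T \<noteq> {}"
      and T: "\<forall>(u, v) \<in> parcs G. u \<in> S \<longrightarrow> v \<in> S \<longrightarrow> (u \<in> T \<longleftrightarrow> v \<in> T)"
    \<comment> \<open>An arc inside \<open>P\<close> has both ends in \<open>S\<close> or neither.
      In the first case \<open>T\<close> respects it by assumption, in the second it misses
      \<open>T\<close> altogether.\<close>
    moreover have "closed T"
      using S T \<open>T \<subseteq> S\<close> unfolding closed_def by fast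
    ultimately have "T \<in> F"
      using S(1) by (simp add: F_def)
    then show "T = S"
      using min \<open>T \<subseteq> S\<close> by blast
  qed (fact S(2))
  then show thesis
    using S(1,3) by (intro that[of S]) (auto simp: closed_def)
qed

section \<open>Graver bases under negation\<close>

lemma zero_mem_int_kernel: "(\<lambda>_. 0) \<in> int_kernel R C A"
  by (simp add: int_kernel_def int_vectors_def matrix_vector_def)

lemma uminus_mem_int_kernel_iff [simp]:
  "- z \<in> int_kernel R C A \<longleftrightarrow> z \<in> int_kernel R C A"
  by (simp add: int_kernel_def int_vectors_def matrix_vector_def sum_negf)

lemma conformal_uminus_left: "conformal C (- y) z \<longleftrightarrow> conformal C y (- z)"
  by (simp add: conformal_def)

text \<open>Negation permutes the kernel and a minus sign moves across \<open>conformal\<close>, so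
  minimality carries over. This covers the sign in the theorem and reduces its proof to vectors with
  a positive vertex entry.\<close>

lemma uminus_graver_basis:
  fixes z :: "'c \<Rightarrow> int"
  assumes "z \<in> graver_basis R C A"
  shows "- z \<in> graver_basis R C A"
proof -
  have eq0: "- y = (\<lambda>_. 0) \<longleftrightarrow> y = (\<lambda>_. 0)" for y :: "'c \<Rightarrow> int"
    by (simp add: fun_eq_iff)
  show ?thesis
    unfolding graver_basis_def
  proof (safe)
    show "- z \<in> int_kernel R C A"
      using assms by (simp add: graver_basis_def)
    show False if "- z = (\<lambda>_. 0)"
      using assms that eq0[of z] by (simp add: graver_basis_def)
    show "y = - z" if "y \<in> int_kernel R C A" "conformal C y (- z)" "y \<noteq> (\<lambda>_. 0)" for y
    proof -
      have "- y \<in> int_kernel R C A - {\<lambda>_. 0}" "conformal C (- y) z"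
        using that eq0 by (auto simp: conformal_uminus_left)
      then have "- y = z"
        using assms by (auto simp: graver_basis_def)
      then show ?thesis
        by force
    qed
  qed
qed

section \<open>Entries of cut vectors\<close>

lemma cut_vector_Inl [simp]: "cut_vector G S (Inl v) = of_bool (v \<in> S)"
  by (simp add: cut_vector_def indicator_def)

text \<open>An arc with both ends in \<open>S\<close> counts as leaving and as entering, so its two
  indicators cancel. The arc part is thus the difference of the indicator of \<open>S\<close> along
  each arc, as the kernel equations demand.\<close>

lemma cut_vector_Inr:
  "cut_vector G S (Inr (u, v)) =
    (if (u, v) \<in> parcs G then of_bool (u \<in> S) - of_bool (v \<in> S) else 0)"
  by (simp add: cut_vector_def arcs_leaving_def arcs_entering_def indicator_def)

lemma cut_vector_nonzero:
  assumes "S \<noteq> {}"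
  shows "cut_vector G S \<noteq> (\<lambda>_. 0)"
proof -
  obtain v where "v \<in> S"
    using assms by blast
  then have "cut_vector G S (Inl v) \<noteq> 0"
    by simp
  then show ?thesis
    by (rule contrapos_nn) simp
qed

section \<open>The kernel of \<open>A_TV\<close> and its minimal elements\<close>

context pair_fin_digraph
begin

lemma mem_int_kernel_A_TV_iff:
  "z \<in> int_kernel (parcs G) (pverts G <+> parcs G) A_TV \<longleftrightarrow>
    z \<in> int_vectors (pverts G <+> parcs G) \<and>
    (\<forall>(u, v) \<in> parcs G. z (Inr (u, v)) = z (Inl u) - z (Inl v))"
proof -
  have "matrix_vector (pverts G <+> parcs G) A_TV z (u, v) = z (Inl u) - z (Inl v) - z (Inr (u, v))"
    if "(u, v) \<in> parcs G" for u v
  proof -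
    have "z = case_sum (\<lambda>v. z (Inl v)) (\<lambda>e. z (Inr e))"
      by (auto simp: fun_eq_iff split: sum.split)
    then show ?thesis
      using matrix_vector_A_TV[OF that, of "\<lambda>v. z (Inl v)" "\<lambda>e. z (Inr e)"] by simp
  qed
  then show ?thesis
    by (fastforce simp: int_kernel_def)
qed

text \<open>Both ends of an arc are vertices, so the vertex entries fix the arc entries. Compared
  with the zero vector, this yields a nonzero vertex entry in every nonzero kernel vector.\<close>

lemma int_kernel_A_TV_eqI:
  assumes y: "y \<in> int_kernel (parcs G) (pverts G <+> parcs G) A_TV"
    and z: "z \<in> int_kernel (parcs G) (pverts G <+> parcs G) A_TV"
    and eq: "\<And>v. v \<in> pverts G \<Longrightarrow> y (Inl v) = z (Inl v)"
  shows "y = z"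
proof
  fix i
  show "y i = z i"
  proof (cases "i \<in> pverts G <+> parcs G")
    case True
    then show ?thesis
    proof (elim PlusE)
      fix e
      assume "e \<in> parcs G" "i = Inr e"
      moreover obtain u v where "e = (u, v)"
        by fastforce
      ultimately show ?thesis
        using y z eq in_arcsD1 in_arcsD2 by (fastforce simp: mem_int_kernel_A_TV_iff)
    qed (simp add: eq)
  next
    case False
    then show ?thesis
      using y z by (simp add: int_kernel_def int_vectors_def)
  qed
qed

lemma cut_vector_mem_int_kernel:
  assumes "S \<subseteq> pverts G"
  shows "cut_vector G S \<in> int_kernel (parcs G) (pverts G <+> parcs G) A_TV"
proof -
  have "cut_vector G S i = 0" if "i \<notin> pverts G <+> parcs G" for i
    using that assms by (cases i) (auto simp: cut_vector_Inr split: if_splits)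
  then show ?thesis
    by (auto simp: mem_int_kernel_A_TV_iff int_vectors_def cut_vector_Inr)
qed

lemma cut_vector_mem_graver_basis:
  assumes S: "S \<subseteq> pverts G" and conn: "Digraph_Component.connected (with_proj G \<restriction> S)"
  shows "cut_vector G S \<in> graver_basis (parcs G) (pverts G <+> parcs G) A_TV"
  unfolding graver_basis_def
proof (safe)
  show "cut_vector G S \<in> int_kernel (parcs G) (pverts G <+> parcs G) A_TV"
    by (rule cut_vector_mem_int_kernel[OF S])
  show False if "cut_vector G S = (\<lambda>_. 0)"
    using that conn cut_vector_nonzero[of S G] by (simp add: connected_induce_iff)
next
  fix y
  assume y: "y \<in> int_kernel (parcs G) (pverts G <+> parcs G) A_TV" "y \<noteq> (\<lambda>_. 0)"
    and conf: "conformal (pverts G <+> parcs G) y (cut_vector G S)"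
  have y_vert: "y (Inl v) \<in> {0, 1} \<and> (v \<notin> S \<longrightarrow> y (Inl v) = 0)" if "v \<in> pverts G" for v
  proof -
    have "y (Inl v) * of_bool (v \<in> S) \<ge> 0 \<and> \<bar>y (Inl v)\<bar> \<le> of_bool (v \<in> S)"
      using conf that unfolding conformal_def by (force dest: bspec[of _ _ "Inl v"])
    then show ?thesis
      by (cases "v \<in> S") auto
  qed
  \<comment> \<open>The cut vector vanishes on arcs inside \<open>S\<close>, hence so does
    \<open>y\<close>.\<close>
  have y_arc: "y (Inl u) = y (Inl v)" if "(u, v) \<in> parcs G" "u \<in> S" "v \<in> S" for u v
  proof -
    have "\<bar>y (Inr (u, v))\<bar> \<le> \<bar>cut_vector G S (Inr (u, v))\<bar>"
      using conf that(1) unfolding conformal_def by blast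
    then show ?thesis
      using y(1) that by (auto simp: cut_vector_Inr mem_int_kernel_A_TV_iff)
  qed
  \<comment> \<open>By \<open>y_vert\<close> this is the vertex support of \<open>y\<close>. It is
    nonempty because \<open>y\<close> is nonzero, and closed by \<open>y_arc\<close>, so
    connectedness makes it all of \<open>S\<close>.\<close>
  define T where "T = {v \<in> S. y (Inl v) = 1}"
  have "T \<noteq> {}"
  proof
    assume "T = {}"
    then have "y (Inl v) = 0" if "v \<in> pverts G" for v
      using y_vert[OF that] by (auto simp: T_def)
    then show False
      using int_kernel_A_TV_eqI[OF y(1) zero_mem_int_kernel] y(2) by blast
  qed
  moreover have "\<forall>(u, v) \<in> parcs G. u \<in> S \<longrightarrow> v \<in> S \<longrightarrow> (u \<in> T \<longleftrightarrow> v \<in> T)"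
    using y_arc by (auto simp: T_def)
  moreover have "T \<subseteq> S"
    by (auto simp: T_def)
  ultimately have "T = S"
    using conn unfolding connected_induce_iff by blast
  then show "y = cut_vector G S"
    using y_vert
    by (intro int_kernel_A_TV_eqI[OF y(1) cut_vector_mem_int_kernel[OF S]]) (auto simp: T_def)
qed

text \<open>Minimality of \<open>z\<close> enters only at the end: any kernel vector with a positive
  vertex entry has a cut vector conformal to it.\<close>

lemma graver_basis_with_positive_vertex:
  assumes z: "z \<in> graver_basis (parcs G) (pverts G <+> parcs G) A_TV"
    and w: "w \<in> pverts G" "z (Inl w) > 0"
  obtains S where "S \<subseteq> pverts G" "Digraph_Component.connected (with_proj G \<restriction> S)"
    and "z = cut_vector G S"
proof -
  define P where "P = {v \<in> pverts G. z (Inl v) > 0}"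
  have "finite P" "P \<noteq> {}"
    using w pair_finite_verts by (auto simp: P_def)
  then obtain S where S: "S \<subseteq> P" "Digraph_Component.connected (with_proj G \<restriction> S)"
    and closed: "\<And>u v. (u, v) \<in> parcs G \<Longrightarrow> u \<in> P \<Longrightarrow> v \<in> P \<Longrightarrow> u \<in> S \<longleftrightarrow> v \<in> S"
    using obtain_connected_component[where G = G] by metis
  have SV: "S \<subseteq> pverts G"
    using S by (auto simp: P_def)
  \<comment> \<open>Integrality turns positivity into the bound 1, the size of the entries of the
    cut vector.\<close>
  have pos: "z (Inl v) \<ge> 1" if "v \<in> S" for v
    using S(1) that by (auto simp: P_def)
  have "conformal (pverts G <+> parcs G) (cut_vector G S) z"
    unfolding conformal_def
  proof
    fix i
    assume "i \<in> pverts G <+> parcs G"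
    then show "0 \<le> cut_vector G S i * z i \<and> \<bar>cut_vector G S i\<bar> \<le> \<bar>z i\<bar>"
    proof (elim PlusE)
      fix v
      assume "i = Inl v"
      then show ?thesis
        using pos[of v] by (cases "v \<in> S") auto
    next
      fix e
      assume e: "e \<in> parcs G" "i = Inr e"
      obtain u v where uv: "e = (u, v)"
        by fastforce
      have arc: "(u, v) \<in> parcs G"
        using e uv by simp
      have zi: "z i = z (Inl u) - z (Inl v)"
        using z e uv by (auto simp: graver_basis_def mem_int_kernel_A_TV_iff)
      have ci: "cut_vector G S i = of_bool (u \<in> S) - of_bool (v \<in> S)"
        using e uv by (simp add: cut_vector_Inr)
      have verts: "u \<in> pverts G" "v \<in> pverts G"
        using arc in_arcsD1 in_arcsD2 by blast+
      \<comment> \<open>If \<open>v\<close> were in \<open>P\<close>, then \<open>closed\<close>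
        would put it into \<open>S\<close>; so its entry is not positive.\<close>
      have "z (Inl v) \<le> 0" if "u \<in> S" "v \<notin> S"
        using closed[OF arc] that S(1) verts by (force simp: P_def)
      moreover have "z (Inl u) \<le> 0" if "u \<notin> S" "v \<in> S"
        using closed[OF arc] that S(1) verts by (force simp: P_def)
      \<comment> \<open>With exactly one end in \<open>S\<close>, the difference of \<open>z\<close>
        has the sign of the cut entry and absolute value at least 1; otherwise the cut entry is
        0.\<close>
      ultimately show ?thesis
        using pos[of u] pos[of v] zi ci by (cases "u \<in> S"; cases "v \<in> S") auto
    qed
  qed
  moreover have "cut_vector G S \<noteq> (\<lambda>_. 0)"
    using S(2) cut_vector_nonzero[of S G] by (simp add: connected_induce_iff)
  ultimately have "z = cut_vector G S"
    using z cut_vector_mem_int_kernel[OF SV] unfolding graver_basis_def by blast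
  then show thesis
    using that SV S(2) by blast
qed

end

theorem theorem1:
  fixes G :: "'v pair_pre_digraph"
  assumes "pair_fin_digraph G"
  shows "graver_basis (parcs G) (pverts G <+> parcs G) A_TV =
    (\<Union>S \<in> {S. S \<subseteq> pverts G \<and> S \<noteq> {} \<and> Digraph_Component.connected (with_proj G \<restriction> S)}.
      {cut_vector G S, - cut_vector G S})"
proof -
  interpret pair_fin_digraph G
    by fact
  show ?thesis
  proof (intro equalityI subsetI)
    fix z
    assume z: "z \<in> graver_basis (parcs G) (pverts G <+> parcs G) A_TV"
    then have "z \<noteq> (\<lambda>_. 0)" and ker: "z \<in> int_kernel (parcs G) (pverts G <+> parcs G) A_TV"
      by (auto simp: graver_basis_def)
    then obtain w where w: "w \<in> pverts G" "z (Inl w) \<noteq> 0"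
      using int_kernel_A_TV_eqI[OF ker zero_mem_int_kernel] by blast
    have "\<exists>S \<subseteq> pverts G. Digraph_Component.connected (with_proj G \<restriction> S) \<and>
        (z = cut_vector G S \<or> - z = cut_vector G S)"
    \<comment> \<open>The sign of a single nonzero vertex entry decides whether \<open>z\<close> or
      \<open>- z\<close> is the cut vector.\<close>
    proof (cases "z (Inl w) > 0")
      case True
      then show ?thesis
        using graver_basis_with_positive_vertex[OF z w(1)] by metis
    next
      case False
      then have "(- z) (Inl w) > 0"
        using w(2) by simp
      then show ?thesis
        using graver_basis_with_positive_vertex[OF uminus_graver_basis[OF z] w(1)] by metis
    qed
    then obtain S where "S \<subseteq> pverts G" and conn: "Digraph_Component.connected (with_proj G \<restriction> S)"
      and "z = cut_vector G S \<or> - z = cut_vector G S"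
      by metis
    moreover have "S \<noteq> {}"
      using conn by (simp add: connected_induce_iff)
    moreover have "z = - cut_vector G S" if "- z = cut_vector G S"
      unfolding that[symmetric] by (simp add: fun_eq_iff)
    ultimately show "z \<in> (\<Union>S \<in> {S. S \<subseteq> pverts G \<and> S \<noteq> {} \<and>
        Digraph_Component.connected (with_proj G \<restriction> S)}. {cut_vector G S, - cut_vector G S})"
      by blast
  next
    fix z
    assume "z \<in> (\<Union>S \<in> {S. S \<subseteq> pverts G \<and> S \<noteq> {} \<and>
        Digraph_Component.connected (with_proj G \<restriction> S)}. {cut_vector G S, - cut_vector G S})"
    then obtain S where "S \<subseteq> pverts G" "Digraph_Component.connected (with_proj G \<restriction> S)"
      and "z = cut_vector G S \<or> z = - cut_vector G S"
      by auto
    then show "z \<in> graver_basis (parcs G) (pverts G <+> parcs G) A_TV"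
      using cut_vector_mem_graver_basis[of S]
        uminus_graver_basis[OF cut_vector_mem_graver_basis[of S]] by metis
  qed
qed

end
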